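(* There exists a constant $\rho>0$ such that for all sufficiently large $n$ and any integer $m\ge\rho^{-1}\cdot n\log n$, the Twinning process on $n$ bins satisfies $$\mathbb{E}[\eta^m]\ge 1+\rho\qquad\text{and}\qquad \Pr[\eta^m\ge 1+\rho]\ge 1-n^{-1/4}.$$
   Context: The Twinning process on $n$ bins starts with the empty load vector $x^0=(0,\dots,0)$; for each round $t\ge0$ it samples one bin $i\in[n]$ uniformly at random (independently of the past) and sets $x_i^{t+1}=x_i^t+2$ if $x_i^t<W^t/n$ and $x_i^{t+1}=x_i^t+1$ if $x_i^t\ge W^t/n$, where $W^t=\sum_{i}x_i^t$ is the total number of balls allocated in the first $t$ rounds; other loads are unchanged. The sample efficiency is $\eta^m=W^m/S^m$, where $S^m$ is the total number of uniform bin samples taken in the first $m$ rounds (so $S^m=m$ for Twinning). *)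

theory Defs
  imports "HOL-Probability.Probability"
begin

text \<open>
  Bins are the numbers \<open>i < n\<close>.  A load vector is a function \<open>nat \<Rightarrow> nat\<close> that stays \<open>0\<close> outside
  \<open>{..<n}\<close>.  A state of the process is a pair \<open>(x, s)\<close> of the load vector and the number of bin
  samples taken so far.
\<close>

definition total_load :: "nat \<Rightarrow> (nat \<Rightarrow> nat) \<Rightarrow> nat" where
  "total_load n x = (\<Sum>i<n. x i)"

definition twinning_alloc :: "nat \<Rightarrow> (nat \<Rightarrow> nat) \<Rightarrow> nat \<Rightarrow> (nat \<Rightarrow> nat)" where
  "twinning_alloc n x i =
     x(i := if real (x i) < real (total_load n x) / real n then x i + 2 else x i + 1)"

text \<open>
  One round; meaningful only for \<open>n \<ge> 1\<close>, since \<open>pmf_of_set {}\<close> is unspecified.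
\<close>

definition twinning_step :: "nat \<Rightarrow> (nat \<Rightarrow> nat) \<times> nat \<Rightarrow> ((nat \<Rightarrow> nat) \<times> nat) pmf" where
  "twinning_step n = (\<lambda>(x, s). map_pmf (\<lambda>i. (twinning_alloc n x i, s + 1)) (pmf_of_set {..<n}))"

text \<open>
  The law of the state after \<open>t\<close> rounds.
\<close>

primrec twinning :: "nat \<Rightarrow> nat \<Rightarrow> ((nat \<Rightarrow> nat) \<times> nat) pmf" where
  "twinning n 0 = return_pmf (\<lambda>_. 0, 0)"
| "twinning n (Suc t) = bind_pmf (twinning n t) (twinning_step n)"

definition sample_efficiency :: "nat \<Rightarrow> (nat \<Rightarrow> nat) \<times> nat \<Rightarrow> real" where
  "sample_efficiency n = (\<lambda>(x, s). real (total_load n x) / real s)"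

lemma twinning_samples: "(x, s) \<in> set_pmf (twinning n t) \<Longrightarrow> s = t"
  by (induction t arbitrary: x s) (auto simp: twinning_step_def)

end

theory Submission
  imports Defs "HOL-Real_Asymp.Real_Asymp"
begin

text \<open>
  Write \<open>y\<^sub>i = x\<^sub>i - W / n\<close>. Let \<open>\<delta>\<close> be the fraction of bins with \<open>y\<^sub>i < 0\<close> and \<open>P\<close> the sum of the
  nonnegative \<open>y\<^sub>i\<close>. In one round \<open>\<Sum>y\<^sub>i\<^sup>2\<close> changes in expectation by at most
  \<open>1 + 3\<delta> - 2P/n\<close>. For the convex function \<open>f\<close> equal to \<open>exp (-y)\<close> on \<open>y \<ge> 0\<close> and to its tangent
  \<open>1 - y\<close> on \<open>y < 0\<close>, the sum \<open>\<Sum>f(y\<^sub>i)\<close> grows in expectation by at least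
  \<open>(1 - P/n)/3 - 4\<delta>/3 - 1/n\<close>, because random arrivals spread the bins out. In the combination
  \<open>\<Psi> = \<Sum>(f(y\<^sub>i) - y\<^sub>i\<^sup>2/6)\<close> the terms in \<open>P\<close> cancel, so that the drift of \<open>\<Psi>\<close> is at least
  \<open>1/6 - 2\<delta> - 1/n\<close>, while \<open>\<Psi> \<le> 5n/2\<close> always. As \<open>\<delta>\<close> is the drift of \<open>W - S\<close>, the process
  \<open>Z = \<Psi> + 2(W - S) - S/12\<close> is a submartingale, which forces \<open>W - S\<close> to grow linearly in expectation.
  For the bound in probability, the second moment of the negative part of \<open>Z\<close> is at most the
  accumulated expected squared increment; this is \<open>O(m + m\<^sup>2/n)\<close>, since the expectation of \<open>\<Sum>y\<^sub>i\<^sup>2\<close> grows at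
  most linearly, and Chebyshev's inequality gives a failure probability \<open>O(1/n)\<close>.
\<close>

section \<open>Deviations from the mean load and the potentials built on them\<close>

definition excess :: "nat \<Rightarrow> (nat \<Rightarrow> nat) \<Rightarrow> nat \<Rightarrow> real" where
  "excess n x i = real (x i) - real (total_load n x) / real n"

text \<open>The value minus 1 is the indicator of a bin below the mean, so the average of
  \<open>balls n x i - 1\<close> over \<open>i\<close> is the fraction delta.\<close>

definition balls :: "nat \<Rightarrow> (nat \<Rightarrow> nat) \<Rightarrow> nat \<Rightarrow> real" where
  "balls n x i = (if excess n x i < 0 then 2 else 1)"

definition decay :: "real \<Rightarrow> real" where
  "decay y = (if y \<ge> 0 then exp (- y) else 1 - y)"

text \<open>Minus the derivative of \<open>decay\<close>; the two branches agree at 0, so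
  \<open>decay\<close> is continuously differentiable.\<close>

definition decay_rate :: "real \<Rightarrow> real" where
  "decay_rate y = (if y \<ge> 0 then exp (- y) else 1)"

definition quad_pot :: "nat \<Rightarrow> (nat \<Rightarrow> nat) \<Rightarrow> real" where
  "quad_pot n x = (\<Sum>i<n. (excess n x i)\<^sup>2)"

definition decay_pot :: "nat \<Rightarrow> (nat \<Rightarrow> nat) \<Rightarrow> real" where
  "decay_pot n x = (\<Sum>i<n. decay (excess n x i))"

definition pot :: "nat \<Rightarrow> (nat \<Rightarrow> nat) \<times> nat \<Rightarrow> real" where
  "pot n = (\<lambda>(x, s). decay_pot n x - quad_pot n x / 6
              + 2 * (real (total_load n x) - real s) - real s / 12)"

section \<open>Analysis of the convex function \<open>decay\<close>\<close>

lemma decay_rate_nonneg: "0 \<le> decay_rate y" and decay_rate_le_1: "decay_rate y \<le> 1"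
  by (auto simp: decay_rate_def)

text \<open>Convexity: the graph lies above each of its tangents. The cases follow the branches on
  which \<open>y\<close> and \<open>z\<close> lie.\<close>

lemma decay_tangent: "decay z \<ge> decay y - decay_rate y * (z - y)"
proof -
  have e: "exp (- z) \<ge> exp (- y) * (1 - (z - y))"
  proof -
    have "exp (- y) * (1 - (z - y)) \<le> exp (- y) * exp (- (z - y))"
      using exp_ge_add_one_self[of "y - z"] by (intro mult_left_mono) (auto simp: algebra_simps)
    also have "\<dots> = exp (- z)" by (simp flip: exp_add)
    finally show ?thesis .
  qed
  have e1: "exp (- z) \<ge> 1 - z"
    using exp_ge_add_one_self[of "- z"] by simp
  \<comment> \<open>The mixed case: the difference of the two sides is
    \<open>(1 - exp (- y) * (1 + y)) - (1 - exp (- y)) * z\<close>, and both summands are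
    nonnegative.\<close>
  have e2: "1 - z \<ge> exp (- y) * (1 - (z - y))" if "y \<ge> 0" "z < 0"
  proof -
    have "exp (- y) * (1 + y) \<le> exp (- y) * exp y"
      using exp_ge_add_one_self[of y] by (intro mult_left_mono) auto
    then have "exp (- y) * (1 + y) \<le> 1" by (simp flip: exp_add)
    moreover have "(1 - exp (- y)) * z \<le> 0"
      using that by (intro mult_nonneg_nonpos) auto
    ultimately show ?thesis by (simp add: algebra_simps)
  qed
  show ?thesis
    using e e1 e2 by (auto simp: decay_def decay_rate_def algebra_simps)
qed

text \<open>All tangent slopes lie between -1 and 0; the tangent inequality is used at both
  points.\<close>

lemma decay_lipschitz: "\<bar>decay z - decay y\<bar> \<le> \<bar>z - y\<bar>"
proof -
  have *: "decay b - decay a \<ge> - \<bar>b - a\<bar>" for a b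
  proof -
    have "\<bar>decay_rate a * (b - a)\<bar> \<le> 1 * \<bar>b - a\<bar>"
      unfolding abs_mult using decay_rate_nonneg[of a] decay_rate_le_1[of a]
      by (intro mult_right_mono) auto
    then have "decay_rate a * (b - a) \<le> \<bar>b - a\<bar>" by (simp only: abs_le_iff mult_1)
    then show ?thesis using decay_tangent[where y = a and z = b] by simp
  qed
  show ?thesis using *[of y z] *[of z y] by (auto simp: abs_minus_commute)
qed

text \<open>The second-order gain from convexity: a ball raises \<open>y\<close> by 1 and the rising
  mean returns \<open>decay_rate y\<close>. For \<open>y >= 0\<close> the terms
  \<open>decay y\<close> and \<open>decay_rate y\<close> cancel, leaving
  \<open>exp (- (y + 1))\<close>.\<close>

lemma decay_step:
  "y \<ge> 0 \<Longrightarrow> decay (y + 1) - decay y + decay_rate y \<ge> (1 - y) / 3"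
proof -
  assume y: "y \<ge> 0"
  have "exp (1::real) \<le> 3" by (rule exp_le)
  then have "exp (- 1 :: real) \<ge> 1 / 3"
    by (simp add: exp_minus field_simps)
  then have "exp (- y) * (1/3) \<le> exp (- y) * exp (- 1)"
    by (intro mult_left_mono) auto
  moreover have "exp (- y) \<ge> 1 - y"
    using exp_ge_add_one_self[of "- y"] by simp
  moreover have "exp (- y) * exp (- 1) = exp (- (y + 1))" by (simp flip: exp_add)
  ultimately show ?thesis using y by (simp add: decay_def decay_rate_def)
qed

lemma decay_minus_square_le: "decay y - y\<^sup>2 / 6 \<le> 5 / 2"
proof (cases "y \<ge> 0")
  case True
  then have "exp (- y) \<le> 1" by simp
  moreover have "y\<^sup>2 / 6 \<ge> 0" by simp
  ultimately have "exp (- y) - y\<^sup>2 / 6 \<le> 5 / 2" by linarith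
  then show ?thesis using True by (simp only: decay_def if_True)
next
  case False
  \<comment> \<open>Completing the square: \<open>1 - y - y^2/6 = 5/2 - (y + 3)^2/6\<close>.\<close>
  have "(y + 3)\<^sup>2 \<ge> 0" by simp
  then show ?thesis using False by (simp add: decay_def power2_eq_square algebra_simps)
qed

section \<open>Change of the potentials under one allocation\<close>

lemma balls_bounds: "1 \<le> balls n x i" "balls n x i \<le> 2"
  by (auto simp: balls_def)

lemma sum_excess: "n > 0 \<Longrightarrow> (\<Sum>i<n. excess n x i) = 0"
  by (simp add: excess_def sum_subtractf total_load_def)

lemma total_load_alloc:
  assumes "i < n"
  shows "real (total_load n (twinning_alloc n x i)) = real (total_load n x) + balls n x i"
proof -
  have "twinning_alloc n x i = (\<lambda>j. x j + (if j = i then (if excess n x i < 0 then 2 else 1) else 0))"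
    by (auto simp: twinning_alloc_def excess_def fun_eq_iff)
  then have "total_load n (twinning_alloc n x i) = total_load n x + (if excess n x i < 0 then 2 else 1)"
    using assms by (simp add: total_load_def sum.distrib)
  then show ?thesis by (simp add: balls_def)
qed

lemma excess_alloc:
  assumes "i < n"
  shows "excess n (twinning_alloc n x i) j =
           excess n x j + (if j = i then balls n x i else 0) - balls n x i / real n"
  using total_load_alloc[OF assms, of x]
  by (auto simp: excess_def twinning_alloc_def balls_def add_divide_distrib)

lemma quad_pot_alloc:
  assumes "i < n"
  shows "quad_pot n (twinning_alloc n x i) =
           quad_pot n x + 2 * balls n x i * excess n x i + (balls n x i)\<^sup>2 * (1 - 1 / real n)"
proof -
  define y h a where "y = excess n x" and "h = balls n x i" and "a = h / real n"
  have s: "(\<Sum>j<n. y j) = 0" using sum_excess assms by (simp add: y_def)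
  have "quad_pot n (twinning_alloc n x i) = (\<Sum>j<n. (y j + (if j = i then h else 0) - a)\<^sup>2)"
    using assms by (simp add: quad_pot_def excess_alloc[OF assms] y_def h_def a_def cong: if_cong)
  \<comment> \<open>The term linear in \<open>y j\<close> sums to 0, and the terms with
    \<open>a\<close> combine to \<open>- 2 * h * a + h * a = - h^2 / n\<close>.\<close>
  also have "\<dots> = (\<Sum>j<n. (y j)\<^sup>2 + (if j = i then 2 * h * y i + h\<^sup>2 - 2 * h * a else 0)
                      - 2 * a * y j + a\<^sup>2)"
    by (intro sum.cong) (auto simp: power2_eq_square algebra_simps)
  also have "\<dots> = quad_pot n x + (2 * h * y i + h\<^sup>2 - 2 * h * a) + real n * a\<^sup>2"
    using assms s by (simp add: sum.distrib sum_subtractf quad_pot_def y_def flip: sum_distrib_left)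
  also have "real n * a\<^sup>2 = h * a"
    using assms by (simp add: a_def power2_eq_square)
  finally show ?thesis
    by (simp add: y_def h_def a_def power2_eq_square algebra_simps)
qed

text \<open>The mean rises by at least \<open>1 / n\<close>, and by the tangent bound each bin gains
  its rate times that. The sampled bin has its rate taken at the raised load; replacing it by the
  old rate costs at most \<open>1 / n\<close>.\<close>

lemma decay_pot_alloc_ge:
  assumes "i < n"
  shows "decay_pot n (twinning_alloc n x i) \<ge> decay_pot n x
           + (decay (excess n x i + balls n x i) - decay (excess n x i))
           + (\<Sum>j<n. decay_rate (excess n x j)) / real n - 1 / real n"
proof -
  define y h a where "y = excess n x" and "h = balls n x i" and "a = 1 / real n"
  have a: "a \<ge> 0" and ha: "h / real n \<ge> a"
    using balls_bounds[of n x i] by (auto simp: a_def h_def divide_right_mono)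
  have "decay (excess n (twinning_alloc n x i) j) \<ge>
          decay (y j) + a * decay_rate (y j) + (if j = i then decay (y i + h) - decay (y i) - a else 0)"
    (is "?l j \<ge> ?r j") if "j < n" for j
  proof -
    \<comment> \<open>The excess after the balls arrive but before the mean is updated.\<close>
    define z where "z = y j + (if j = i then h else 0)"
    have "?l j = decay (z - h / real n)"
      using excess_alloc[OF assms, of x j] by (simp add: z_def y_def h_def)
    also have "\<dots> \<ge> decay z + decay_rate z * (h / real n)"
      using decay_tangent[of z "z - h / real n"] by simp
    finally have "?l j \<ge> decay z + decay_rate z * a"
      using mult_left_mono[OF ha decay_rate_nonneg[of z]] by linarith
    moreover have "a * decay_rate (y i) \<le> a"
      using mult_left_mono[OF decay_rate_le_1[of "y i"] a] by simp
    moreover have "0 \<le> decay_rate z * a" using a decay_rate_nonneg by simp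
    ultimately show ?thesis by (auto simp: z_def mult.commute)
  qed
  then have "(\<Sum>j<n. ?r j) \<le> (\<Sum>j<n. ?l j)" by (intro sum_mono) auto
  then show ?thesis
    using assms
    by (simp add: sum.distrib decay_pot_def y_def h_def a_def flip: sum_distrib_left sum_divide_distrib)
qed

text \<open>The excesses move by at most \<open>2 * balls n x i\<close> in total: one share in the
  sampled bin, one spread over all bins by the mean.\<close>

lemma decay_pot_alloc_lipschitz:
  assumes "i < n"
  shows "\<bar>decay_pot n (twinning_alloc n x i) - decay_pot n x\<bar> \<le> 4"
proof -
  let ?h = "balls n x i"
  have h: "1 \<le> ?h" "?h \<le> 2" by (rule balls_bounds)+
  have "\<bar>decay_pot n (twinning_alloc n x i) - decay_pot n x\<bar>
      \<le> (\<Sum>j<n. \<bar>decay (excess n (twinning_alloc n x i) j) - decay (excess n x j)\<bar>)"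
    by (simp add: decay_pot_def flip: sum_subtractf)
  also have "\<dots> \<le> (\<Sum>j<n. (if j = i then ?h else 0) + ?h / real n)"
  proof (intro sum_mono)
    fix j
    have "\<bar>?h - v\<bar> \<le> ?h + v" "\<bar>v\<bar> \<le> v" if "0 \<le> v" for v
      using h that by (auto simp: abs_le_iff)
    from this[of "?h / real n"] have "\<bar>excess n (twinning_alloc n x i) j - excess n x j\<bar> \<le> (if j = i then ?h else 0) + ?h / real n"
      using h unfolding excess_alloc[OF assms] by (cases "j = i") auto
    then show "\<bar>decay (excess n (twinning_alloc n x i) j) - decay (excess n x j)\<bar>
                 \<le> (if j = i then ?h else 0) + ?h / real n"
      using decay_lipschitz order_trans by blast
  qed
  also have "\<dots> = 2 * ?h" using assms by (simp add: sum.distrib)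
  finally show ?thesis using h by linarith
qed

section \<open>Expectations along the process, all over finite supports\<close>

lemma expectation_twinning_step:
  assumes "n > 0"
  shows "measure_pmf.expectation (twinning_step n (x, s)) F =
           (\<Sum>i<n. F (twinning_alloc n x i, s + 1)) / real n"
proof -
  have "{..<n} \<noteq> {}" using assms by auto
  then show ?thesis by (simp add: twinning_step_def integral_pmf_of_set)
qed

lemma finite_twinning_step: "n > 0 \<Longrightarrow> finite (set_pmf (twinning_step n st))"
  by (cases st) (auto simp: twinning_step_def lessThan_empty_iff)

lemma finite_twinning: "n > 0 \<Longrightarrow> finite (set_pmf (twinning n t))"
  by (induction t) (auto simp: finite_twinning_step)

lemma integrable_twinning: "n > 0 \<Longrightarrow> integrable (measure_pmf (twinning n t)) (F :: _ \<Rightarrow> real)"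
  by (simp add: integrable_measure_pmf_finite finite_twinning)

text \<open>Tower property in inequality form; it turns each one-round drift bound into a recursion
  on expectations.\<close>

lemma expectation_twinning_Suc_le:
  fixes F G :: "(nat \<Rightarrow> nat) \<times> nat \<Rightarrow> real"
  assumes "n > 0"
    and "\<And>x s. (\<Sum>i<n. F (twinning_alloc n x i, s + 1)) / real n \<le> G (x, s)"
  shows "measure_pmf.expectation (twinning n (Suc t)) F \<le> measure_pmf.expectation (twinning n t) G"
proof -
  have "measure_pmf.expectation (twinning n (Suc t)) F =
          (\<Sum>a\<in>set_pmf (twinning n t). pmf (twinning n t) a * measure_pmf.expectation (twinning_step n a) F)"
    using assms(1)
    by (simp add: pmf_expectation_bind[OF finite_twinning[of n t]] finite_twinning_step)
  also have "\<dots> \<le> (\<Sum>a\<in>set_pmf (twinning n t). pmf (twinning n t) a * G a)"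
    using assms by (intro sum_mono mult_left_mono) (auto simp: expectation_twinning_step)
  also have "\<dots> = measure_pmf.expectation (twinning n t) G"
    using assms(1) by (subst integral_measure_pmf_real[of "set_pmf (twinning n t)"])
      (auto simp: finite_twinning mult.commute)
  finally show ?thesis .
qed

section \<open>Drift of the potentials\<close>

lemma sum_balls_excess:
  assumes "n > 0"
  shows "(\<Sum>i<n. balls n x i * excess n x i) = - (\<Sum>i<n. max 0 (excess n x i))"
proof -
  have "balls n x i * excess n x i = 2 * excess n x i - max 0 (excess n x i)" for i
    by (auto simp: balls_def)
  then show ?thesis
    using sum_excess[OF assms, of x] by (simp add: sum_subtractf flip: sum_distrib_left)
qed

lemma quad_pot_drift:
  assumes "n > 0"
  shows "(\<Sum>i<n. quad_pot n (twinning_alloc n x i)) / real n \<le> quad_pot n x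
           + (1 + 3 * (\<Sum>i<n. balls n x i - 1) / real n - 2 * (\<Sum>i<n. max 0 (excess n x i)) / real n)"
proof -
  have *: "quad_pot n (twinning_alloc n x i) \<le> quad_pot n x
          + 2 * (balls n x i * excess n x i) + (1 + 3 * (balls n x i - 1))" if "i < n" for i
  proof -
    \<comment> \<open>\<open>balls\<close> takes only the values 1 and 2, so its square is affine in
      it.\<close>
    have "(balls n x i)\<^sup>2 = 1 + 3 * (balls n x i - 1)" by (simp add: balls_def)
    moreover have "(balls n x i)\<^sup>2 * (1 - 1 / real n) \<le> (balls n x i)\<^sup>2 * 1"
      by (intro mult_left_mono) auto
    ultimately show ?thesis using quad_pot_alloc[OF that, of x] by simp
  qed
  have "(\<Sum>i<n. quad_pot n (twinning_alloc n x i)) \<le> (\<Sum>i<n. quad_pot n x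
          + 2 * (balls n x i * excess n x i) + (1 + 3 * (balls n x i - 1)))"
    using * by (intro sum_mono) auto
  also have "\<dots> = real n * quad_pot n x - 2 * (\<Sum>i<n. max 0 (excess n x i))
                   + (real n + 3 * (\<Sum>i<n. balls n x i - 1))"
    using sum_balls_excess[OF assms, of x]
    by (simp only: sum.distrib flip: sum_distrib_left) (simp del: sum_subtractf)
  finally have "(\<Sum>i<n. quad_pot n (twinning_alloc n x i)) \<le> real n * quad_pot n x
      - 2 * (\<Sum>i<n. max 0 (excess n x i)) + (real n + 3 * (\<Sum>i<n. balls n x i - 1))" .
  from divide_right_mono[OF this, of "real n"] show ?thesis
    using assms by (simp add: add_divide_distrib diff_divide_distrib)
qed

text \<open>Summed over the sampled bin, the shared average of rates becomes one full rate per bin,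
  which reduces the claim to an inequality for a single bin.\<close>

lemma decay_pot_drift:
  assumes "n > 0"
  shows "(\<Sum>i<n. decay_pot n (twinning_alloc n x i)) / real n \<ge> decay_pot n x
           + (1 / 3 - (\<Sum>i<n. max 0 (excess n x i)) / (3 * real n)
              - 4 / 3 * (\<Sum>i<n. balls n x i - 1) / real n - 1 / real n)"
proof -
  define R where "R = (\<Sum>j<n. decay_rate (excess n x j))"
  let ?y = "excess n x" and ?b = "balls n x"
  \<comment> \<open>The factor 4/3 fits the underloaded case: a loss of at most 2 and a rate of 1
    give \<open>-1 = 1/3 - 4/3\<close>.\<close>
  have *: "decay (?y i + ?b i) - decay (?y i) + decay_rate (?y i)
             \<ge> 1 / 3 - max 0 (?y i) / 3 - 4 / 3 * (?b i - 1)" for i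
  proof (cases "?y i < 0")
    case True
    then have "decay (?y i + ?b i) - decay (?y i) \<ge> - 2"
      using decay_lipschitz[of "?y i + 2" "?y i"] by (simp add: balls_def)
    then show ?thesis using True by (simp add: balls_def decay_rate_def)
  next
    case False
    then show ?thesis using decay_step[of "?y i"] by (simp add: balls_def diff_divide_distrib)
  qed
  have "(\<Sum>i<n. 1 / 3 - max 0 (?y i) / 3 - 4 / 3 * (?b i - 1))
          \<le> (\<Sum>i<n. decay (?y i + ?b i) - decay (?y i) + decay_rate (?y i))"
    using * by (intro sum_mono) auto
  also have "\<dots> = (\<Sum>i<n. decay (?y i + ?b i) - decay (?y i)) + R"
    by (simp add: sum.distrib R_def)
  also have "(\<Sum>i<n. 1 / 3 - max 0 (?y i) / 3 - 4 / 3 * (?b i - 1))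
      = real n / 3 - (\<Sum>i<n. max 0 (?y i)) / 3 - 4 / 3 * (\<Sum>i<n. ?b i - 1)"
    by (simp only: sum_subtractf[of _ "\<lambda>i. 4 / 3 * (?b i - 1)"] sum_subtractf[of "\<lambda>_. 1/3"]
          flip: sum_distrib_left sum_divide_distrib) (simp del: sum_subtractf)
  finally have L: "real n / 3 - (\<Sum>i<n. max 0 (?y i)) / 3 - 4 / 3 * (\<Sum>i<n. ?b i - 1)
      \<le> (\<Sum>i<n. decay (?y i + ?b i) - decay (?y i)) + R" .
  have "(\<Sum>i<n. decay_pot n x + (decay (?y i + ?b i) - decay (?y i)) + (R / real n - 1 / real n))
          \<le> (\<Sum>i<n. decay_pot n (twinning_alloc n x i))"
    using decay_pot_alloc_ge[of _ n x] by (intro sum_mono) (simp add: R_def algebra_simps)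
  then have "real n * decay_pot n x + (\<Sum>i<n. decay (?y i + ?b i) - decay (?y i)) + (R - 1)
          \<le> (\<Sum>i<n. decay_pot n (twinning_alloc n x i))"
    using assms by (simp only: sum.distrib) (simp add: algebra_simps del: sum_subtractf)
  with L have "real n * decay_pot n x + (real n / 3 - (\<Sum>i<n. max 0 (?y i)) / 3 - 4 / 3 * (\<Sum>i<n. ?b i - 1)) - 1
          \<le> (\<Sum>i<n. decay_pot n (twinning_alloc n x i))"
    by linarith
  from divide_right_mono[OF this, of "real n"] show ?thesis
    using assms by (simp add: add_divide_distrib diff_divide_distrib)
qed

text \<open>The weight 1/6 cancels \<open>P\<close>, leaving a drift of at least
  \<open>1/6 - 11/6 * D - 1/n\<close> from the first two terms. The term \<open>2 * D\<close> covers
  the loss in \<open>D\<close>, and \<open>n >= 12\<close> makes \<open>1/6 - 1/n - 1/12\<close>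
  nonnegative.\<close>

lemma pot_submartingale:
  assumes "n \<ge> 12"
  shows "pot n (x, s) \<le> (\<Sum>i<n. pot n (twinning_alloc n x i, s + 1)) / real n"
proof -
  define D where "D = (\<Sum>i<n. balls n x i - 1) / real n"
  define P where "P = (\<Sum>i<n. max 0 (excess n x i)) / real n"
  have n: "n > 0" "1 / real n \<le> 1 / 12" using assms by (auto simp: field_simps)
  have D: "D \<ge> 0" unfolding D_def using balls_bounds by (intro divide_nonneg_nonneg sum_nonneg) auto
  let ?q = "(\<Sum>i<n. quad_pot n (twinning_alloc n x i)) / real n"
  let ?d = "(\<Sum>i<n. decay_pot n (twinning_alloc n x i)) / real n"
  have q: "?q \<le> quad_pot n x + (1 + 3 * D - 2 * P)"
    using quad_pot_drift[OF n(1), of x] by (simp add: D_def P_def)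
  have d: "?d \<ge> decay_pot n x + (1 / 3 - P / 3 - 4 / 3 * D - 1 / real n)"
    using decay_pot_drift[OF n(1), of x] by (simp add: D_def P_def)
  have "pot n (twinning_alloc n x i, s + 1) = decay_pot n (twinning_alloc n x i)
          - quad_pot n (twinning_alloc n x i) / 6 + 2 * (balls n x i - 1)
          + (2 * (real (total_load n x) - real s) - real (s + 1) / 12)" if "i < n" for i
    using total_load_alloc[OF that, of x] by (simp add: pot_def field_simps)
  then have "(\<Sum>i<n. pot n (twinning_alloc n x i, s + 1)) = (\<Sum>i<n. decay_pot n (twinning_alloc n x i)
          - quad_pot n (twinning_alloc n x i) / 6 + 2 * (balls n x i - 1)
          + (2 * (real (total_load n x) - real s) - real (s + 1) / 12))"
    by (intro sum.cong) auto
  also have "\<dots> = (\<Sum>i<n. decay_pot n (twinning_alloc n x i))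
          - (\<Sum>i<n. quad_pot n (twinning_alloc n x i)) / 6 + 2 * (\<Sum>i<n. balls n x i - 1)
          + real n * (2 * (real (total_load n x) - real s) - real (s + 1) / 12)"
    by (simp only: sum.distrib sum_subtractf[of "\<lambda>i. decay_pot n (twinning_alloc n x i)"]
          sum_constant card_lessThan flip: sum_distrib_left sum_divide_distrib)
  finally have "(\<Sum>i<n. pot n (twinning_alloc n x i, s + 1)) / real n =
      ?d - ?q / 6 + 2 * D + (2 * (real (total_load n x) - real s) - real (s + 1) / 12)"
    using n by (simp add: D_def add_divide_distrib diff_divide_distrib)
  moreover have "pot n (x, s) = decay_pot n x - quad_pot n x / 6
                   + 2 * (real (total_load n x) - real s) - real s / 12"
    by (simp add: pot_def)
  moreover have "real (s + 1) = real s + 1" by simp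
  ultimately show ?thesis using q d D n(2) by argo
qed

section \<open>Second moment of the negative part of \<open>pot\<close>\<close>

lemma pot_increment:
  assumes "i < n"
  shows "(pot n (twinning_alloc n x i, s + 1) - pot n (x, s))\<^sup>2 \<le> 128 + 2 * (excess n x i)\<^sup>2"
proof -
  let ?h = "balls n x i" and ?y = "excess n x i"
  define u where "u = quad_pot n (twinning_alloc n x i) - quad_pot n x"
  have h: "1 \<le> ?h" "?h \<le> 2" by (rule balls_bounds)+
  have "\<bar>u\<bar> \<le> \<bar>2 * ?h * ?y\<bar> + \<bar>?h\<^sup>2 * (1 - 1 / real n)\<bar>"
    using quad_pot_alloc[OF assms, of x] by (simp add: u_def)
  also have "\<bar>2 * ?h * ?y\<bar> \<le> 4 * \<bar>?y\<bar>"
    unfolding abs_mult using h by (intro mult_right_mono) auto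
  also have "\<bar>?h\<^sup>2 * (1 - 1 / real n)\<bar> \<le> 4 * 1"
    unfolding abs_mult using h assms power_mono[of ?h 2 2] by (intro mult_mono) auto
  finally have u: "\<bar>u\<bar> \<le> 4 * \<bar>?y\<bar> + 4" by simp
  have "pot n (twinning_alloc n x i, s + 1) - pot n (x, s) =
      (decay_pot n (twinning_alloc n x i) - decay_pot n x) - u / 6 + 2 * (?h - 1) - 1 / 12"
    using total_load_alloc[OF assms, of x] by (simp add: pot_def u_def field_simps)
  \<comment> \<open>The four terms are at most 4, \<open>(4 * \<bar>?y\<bar> + 4) / 6\<close>, 2 and
    1/12 in absolute value.\<close>
  moreover have "\<bar>p - u / 6 + 2 * (?h - 1) - 1 / 12\<bar> \<le> 8 + \<bar>?y\<bar>" if "\<bar>p\<bar> \<le> 4" for p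
    using u h that by argo
  ultimately have "\<bar>pot n (twinning_alloc n x i, s + 1) - pot n (x, s)\<bar> \<le> 8 + \<bar>?y\<bar>"
    using decay_pot_alloc_lipschitz[OF assms, of x] by (simp only:)
  then have "(pot n (twinning_alloc n x i, s + 1) - pot n (x, s))\<^sup>2 \<le> (8 + \<bar>?y\<bar>)\<^sup>2"
    by (simp add: abs_le_square_iff[symmetric])
  also have "\<dots> \<le> 128 + 2 * ?y\<^sup>2"
    using sum_squares_bound[of 8 "\<bar>?y\<bar>"] by (simp add: power2_sum)
  finally show ?thesis .
qed

text \<open>A second-order upper bound for the square of the negative part. Its linear coefficient
  is never positive, so a nonnegative drift can only help.\<close>

lemma neg_part_square_add:
  fixes z d :: real
  shows "(min 0 (z + d))\<^sup>2 \<le> (min 0 z)\<^sup>2 + 2 * min 0 z * d + d\<^sup>2"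
proof -
  have "\<bar>min 0 (z + d)\<bar> \<le> \<bar>min 0 z + d\<bar>" if "z \<le> 0"
    using that by (auto simp: min_def)
  moreover have "\<bar>min 0 (z + d)\<bar> \<le> \<bar>d\<bar>" if "z \<ge> 0"
    using that by (auto simp: min_def)
  ultimately have "\<bar>min 0 (z + d)\<bar> \<le> \<bar>min 0 z + d\<bar>"
    by (cases "z \<le> 0") auto
  then have "(min 0 (z + d))\<^sup>2 \<le> (min 0 z + d)\<^sup>2"
    by (simp only: abs_le_square_iff)
  then show ?thesis by (simp add: power2_sum algebra_simps)
qed

lemma neg_pot_square_drift:
  assumes "n \<ge> 12"
  shows "(\<Sum>i<n. (min 0 (pot n (twinning_alloc n x i, s + 1)))\<^sup>2) / real n
           \<le> (min 0 (pot n (x, s)))\<^sup>2 + 128 + 2 * quad_pot n x / real n"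
proof -
  define z where "z = pot n (x, s)"
  define d where "d i = pot n (twinning_alloc n x i, s + 1) - z" for i
  have n: "real n > 0" using assms by simp
  have "real n * z \<le> (\<Sum>i<n. pot n (twinning_alloc n x i, s + 1))"
    using pot_submartingale[OF assms, of x s] n by (simp add: z_def field_simps)
  then have "(\<Sum>i<n. d i) \<ge> 0" by (simp add: d_def sum_subtractf)
  then have drift: "2 * min 0 z * (\<Sum>i<n. d i) \<le> 0" by (simp add: mult_nonpos_nonneg)
  have "(\<Sum>i<n. (min 0 (pot n (twinning_alloc n x i, s + 1)))\<^sup>2)
          \<le> (\<Sum>i<n. (min 0 z)\<^sup>2 + 2 * min 0 z * d i + (128 + 2 * (excess n x i)\<^sup>2))"
  proof (intro sum_mono)
    fix i assume "i \<in> {..<n}"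
    then have "(d i)\<^sup>2 \<le> 128 + 2 * (excess n x i)\<^sup>2"
      using pot_increment[of i n x s] by (simp add: d_def z_def)
    then show "(min 0 (pot n (twinning_alloc n x i, s + 1)))\<^sup>2
                 \<le> (min 0 z)\<^sup>2 + 2 * min 0 z * d i + (128 + 2 * (excess n x i)\<^sup>2)"
      using neg_part_square_add[of z "d i"] by (simp add: d_def)
  qed
  also have "\<dots> = real n * (min 0 z)\<^sup>2 + 2 * min 0 z * (\<Sum>i<n. d i) + (128 * real n + 2 * quad_pot n x)"
    by (simp add: sum.distrib quad_pot_def flip: sum_distrib_left)
  finally have "(\<Sum>i<n. (min 0 (pot n (twinning_alloc n x i, s + 1)))\<^sup>2)
      \<le> real n * (min 0 z)\<^sup>2 + (128 * real n + 2 * quad_pot n x)"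
    using drift by linarith
  then show ?thesis using n by (simp add: z_def field_simps)
qed

text \<open>A crude bound suffices: with delta at most 1 and \<open>P >= 0\<close>, the drift is at
  most \<open>1 + 3\<close>.\<close>

lemma expectation_quad_pot:
  assumes "n > 0"
  shows "measure_pmf.expectation (twinning n t) (\<lambda>st. quad_pot n (fst st)) \<le> 4 * real t"
proof (induction t)
  case 0
  show ?case by (simp add: quad_pot_def excess_def total_load_def)
next
  case (Suc t)
  have "measure_pmf.expectation (twinning n (Suc t)) (\<lambda>st. quad_pot n (fst st))
          \<le> measure_pmf.expectation (twinning n t) (\<lambda>st. quad_pot n (fst st) + 4)"
  proof (rule expectation_twinning_Suc_le[OF assms])
    fix x :: "nat \<Rightarrow> nat" and s :: nat
    have "(\<Sum>i<n. balls n x i - 1) \<le> (\<Sum>i<n. 1)"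
      using balls_bounds(2)[of n x] by (intro sum_mono) (simp add: algebra_simps)
    then have "(\<Sum>i<n. balls n x i - 1) / real n \<le> 1" using assms by simp
    moreover have "(\<Sum>i<n. max 0 (excess n x i)) / real n \<ge> 0" by (simp add: sum_nonneg)
    ultimately show "(\<Sum>i<n. quad_pot n (fst (twinning_alloc n x i, s + 1))) / real n
                       \<le> quad_pot n (fst (x, s)) + 4"
      using quad_pot_drift[OF assms, of x] by simp
  qed
  with Suc show ?case using integrable_twinning[OF assms] by simp
qed

lemma expectation_neg_pot_square:
  assumes "n \<ge> 12"
  shows "measure_pmf.expectation (twinning n t) (\<lambda>st. (min 0 (pot n st))\<^sup>2)
           \<le> 128 * real t + 8 * (real t)\<^sup>2 / real n"
proof (induction t)
  case 0
  \<comment> \<open>Initially all excesses are 0 and \<open>pot\<close> equals \<open>n\<close>, so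
    its negative part vanishes.\<close>
  show ?case
    by (simp add: pot_def decay_pot_def decay_def quad_pot_def excess_def total_load_def)
next
  case (Suc t)
  have n: "n > 0" using assms by simp
  have "measure_pmf.expectation (twinning n (Suc t)) (\<lambda>st. (min 0 (pot n st))\<^sup>2)
     \<le> measure_pmf.expectation (twinning n t) (\<lambda>st. (min 0 (pot n st))\<^sup>2 + 128 + 2 * quad_pot n (fst st) / real n)"
    using neg_pot_square_drift[OF assms] by (intro expectation_twinning_Suc_le[OF n]) simp
  also have "\<dots> = measure_pmf.expectation (twinning n t) (\<lambda>st. (min 0 (pot n st))\<^sup>2) + 128
                   + 2 * measure_pmf.expectation (twinning n t) (\<lambda>st. quad_pot n (fst st)) / real n"
    using integrable_twinning[OF n] by simp
  also have "\<dots> \<le> (128 * real t + 8 * (real t)\<^sup>2 / real n) + 128 + 2 * (4 * real t) / real n"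
    using Suc expectation_quad_pot[OF n, of t]
    by (intro add_mono divide_right_mono mult_left_mono) auto
  also have "\<dots> \<le> 128 * real (Suc t) + 8 * (real (Suc t))\<^sup>2 / real n"
    using n by (simp add: field_simps power2_eq_square)
  finally show ?case .
qed

lemma expectation_pot_nonneg:
  assumes "n \<ge> 12"
  shows "measure_pmf.expectation (twinning n t) (pot n) \<ge> 0"
proof (induction t)
  case 0
  show ?case
    by (simp add: pot_def decay_pot_def decay_def quad_pot_def excess_def total_load_def)
next
  case (Suc t)
  have n: "n > 0" using assms by simp
  \<comment> \<open>The recursion lemma gives upper bounds, hence the negation.\<close>
  have "measure_pmf.expectation (twinning n (Suc t)) (\<lambda>st. - pot n st)
          \<le> measure_pmf.expectation (twinning n t) (\<lambda>st. - pot n st)"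
    using pot_submartingale[OF assms] n
    by (intro expectation_twinning_Suc_le) (simp_all add: sum_negf)
  then show ?case using Suc by simp
qed

section \<open>From the potential to the sample efficiency\<close>

lemma pot_le: "pot n (x, s) \<le> 5 / 2 * real n + 2 * (real (total_load n x) - real s) - real s / 12"
proof -
  have "decay_pot n x - quad_pot n x / 6 = (\<Sum>i<n. decay (excess n x i) - (excess n x i)\<^sup>2 / 6)"
    by (simp add: decay_pot_def quad_pot_def sum_subtractf sum_divide_distrib)
  also have "\<dots> \<le> (\<Sum>i<n. 5 / 2)" using decay_minus_square_le by (intro sum_mono) auto
  finally show ?thesis by (simp add: pot_def)
qed

lemma pot_le_efficiency:
  assumes "st \<in> set_pmf (twinning n m)" "m > 0"
  shows "pot n st \<le> 5 / 2 * real n + 2 * real m * (sample_efficiency n st - 1) - real m / 12"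
proof -
  obtain x s where st: "st = (x, s)" by force
  then have s: "s = m" using assms twinning_samples by blast
  then have "real m * (sample_efficiency n st - 1) = real (total_load n x) - real s"
    using assms(2) st by (simp add: sample_efficiency_def right_diff_distrib)
  then show ?thesis using pot_le[of n x s] st s by (simp add: mult.assoc)
qed

lemma expectation_efficiency_ge:
  assumes "n \<ge> 12" "real m \<ge> 100 * real n"
  shows "measure_pmf.expectation (twinning n m) (sample_efficiency n) \<ge> 1 + 1 / 100"
proof -
  have n: "n > 0" and m: "m > 0" using assms by (auto intro!: Nat.gr0I)
  note int = integrable_twinning[OF n]
  let ?E = "measure_pmf.expectation (twinning n m)"
  have "0 \<le> ?E (pot n)" using expectation_pot_nonneg[OF assms(1)] .
  also have "\<dots> \<le> ?E (\<lambda>st. 5 / 2 * real n + 2 * real m * (sample_efficiency n st - 1) - real m / 12)"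
    using pot_le_efficiency m by (intro integral_mono_AE int) (auto simp: AE_measure_pmf_iff)
  also have "\<dots> = 5 / 2 * real n + 2 * real m * (?E (sample_efficiency n) - 1) - real m / 12"
    using int by simp
  finally have "0 \<le> 5 / 2 * real n + 2 * real m * (?E (sample_efficiency n) - 1) - real m / 12" .
  \<comment> \<open>As \<open>5/2 * n <= m/40\<close>, the margin is
    \<open>1/12 - 1/40 = 7/120 >= 1/50\<close>.\<close>
  then have "real m * (2 * (?E (sample_efficiency n) - 1)) \<ge> real m * (1 / 50)"
    using assms(2) by (simp add: algebra_simps)
  then show ?thesis using m by simp
qed

lemma prob_efficiency_less:
  assumes "n \<ge> 12" "real m \<ge> 100 * real n"
  shows "measure_pmf.prob (twinning n m) {st. sample_efficiency n st < 1 + 1 / 100} \<le> 122400 / real n"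
proof -
  have n: "n > 0" and m: "m > 0" using assms by (auto intro!: Nat.gr0I)
  note int = integrable_twinning[OF n]
  let ?M = "measure_pmf (twinning n m)" and ?F = "\<lambda>st. (min 0 (pot n st))\<^sup>2"
  have "measure_pmf.prob (twinning n m) {st. sample_efficiency n st < 1 + 1 / 100}
          \<le> measure_pmf.prob (twinning n m) {st. ?F st \<ge> (real m / 30)\<^sup>2}"
  proof (rule measure_pmf.finite_measure_mono_AE)
    have "?F st \<ge> (real m / 30)\<^sup>2"
      if "st \<in> set_pmf (twinning n m)" "sample_efficiency n st < 1 + 1 / 100" for st
    proof -
      have "real m * (sample_efficiency n st - 1) \<le> real m * (1 / 100)"
        using that by (intro mult_left_mono) auto
      \<comment> \<open>Here \<open>1/40 + 1/50 - 1/12 = -23/600\<close>, which is below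
        \<open>-1/30\<close>.\<close>
      then have "pot n st \<le> - (real m / 30)"
        using pot_le_efficiency[OF that(1) m] assms(2) by (simp add: algebra_simps)
      then have "\<bar>real m / 30\<bar> \<le> \<bar>min 0 (pot n st)\<bar>" by (simp add: min_def)
      then show ?thesis by (simp only: abs_le_square_iff)
    qed
    then show "AE st in ?M. st \<in> {st. sample_efficiency n st < 1 + 1 / 100}
                 \<longrightarrow> st \<in> {st. ?F st \<ge> (real m / 30)\<^sup>2}"
      by (auto simp: AE_measure_pmf_iff)
  qed simp
  also have "\<dots> \<le> measure_pmf.expectation (twinning n m) ?F / (real m / 30)\<^sup>2"
    using integral_Markov_inequality_measure[of ?M ?F UNIV "(real m / 30)\<^sup>2"] int m by simp
  also have "\<dots> \<le> (128 * real m + 8 * (real m)\<^sup>2 / real n) / (real m / 30)\<^sup>2"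
    using expectation_neg_pot_square[OF assms(1)] by (intro divide_right_mono) auto
  \<comment> \<open>The factor 900 from the threshold \<open>m / 30\<close> yields
    \<open>128 * 900\<close> and \<open>8 * 900\<close>.\<close>
  also have "\<dots> = 115200 / real m + 7200 / real n"
    using m n by (simp add: field_simps power2_eq_square)
  also have "\<dots> \<le> 115200 / real n + 7200 / real n"
    using assms(2) n by (intro add_mono divide_left_mono) auto
  finally show ?thesis by (simp add: add_divide_distrib[symmetric])
qed

theorem lemma3p4:
  "\<exists>\<rho>::real. \<rho> > 0 \<and>
     (\<forall>\<^sub>F n::nat in sequentially. \<forall>m::nat. real m \<ge> inverse \<rho> * (real n * ln (real n)) \<longrightarrow>
        measure_pmf.expectation (twinning n m) (sample_efficiency n) \<ge> 1 + \<rho> \<and>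
        measure_pmf.prob (twinning n m) {st. sample_efficiency n st \<ge> 1 + \<rho>}
          \<ge> 1 - real n powr (- (1 / 4)))"
\<comment> \<open>The witness 1/100 is both the gain and the reciprocal of the factor in
  \<open>m >= 100 * n\<close>, which follows once \<open>ln n >= 1\<close>.\<close>
proof (intro exI[of _ "1 / 100"] conjI)
  have "\<forall>\<^sub>F n::nat in sequentially. 122400 / real n \<le> real n powr (- (1 / 4))"
    by real_asymp
  moreover have "\<forall>\<^sub>F n::nat in sequentially. ln (real n) \<ge> 1"
    by real_asymp
  ultimately show "\<forall>\<^sub>F n::nat in sequentially. \<forall>m::nat.
      real m \<ge> inverse (1 / 100) * (real n * ln (real n)) \<longrightarrow>
        measure_pmf.expectation (twinning n m) (sample_efficiency n) \<ge> 1 + 1 / 100 \<and>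
        measure_pmf.prob (twinning n m) {st. sample_efficiency n st \<ge> 1 + 1 / 100}
          \<ge> 1 - real n powr (- (1 / 4))"
    using eventually_ge_at_top[of 12]
  proof eventually_elim
    case (elim n)
    show ?case
    proof (intro allI impI)
      fix m :: nat
      assume "real m \<ge> inverse (1 / 100) * (real n * ln (real n))"
      moreover have "real n * ln (real n) \<ge> real n * 1"
        using elim by (intro mult_left_mono) auto
      ultimately have m: "real m \<ge> 100 * real n" by simp
      have "{st. sample_efficiency n st \<ge> 1 + 1 / 100} = - {st. sample_efficiency n st < 1 + 1 / 100}"
        by auto
      then have "measure_pmf.prob (twinning n m) {st. sample_efficiency n st \<ge> 1 + 1 / 100}
          = 1 - measure_pmf.prob (twinning n m) {st. sample_efficiency n st < 1 + 1 / 100}"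
        using measure_pmf.prob_compl[of "{st. sample_efficiency n st < 1 + 1 / 100}" "twinning n m"]
        by (simp add: Compl_eq_Diff_UNIV)
      then show "measure_pmf.expectation (twinning n m) (sample_efficiency n) \<ge> 1 + 1 / 100 \<and>
        measure_pmf.prob (twinning n m) {st. sample_efficiency n st \<ge> 1 + 1 / 100}
          \<ge> 1 - real n powr (- (1 / 4))"
        using expectation_efficiency_ge[of n m] prob_efficiency_less[of n m] elim m by simp
    qed
  qed
qed simp

end
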